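(* Let $B_n(t)=\sum_{k=0}^n\binom nk^2t^k$ be the Narayana polynomials of type $B$ and $L_n(x,s)$ the Lucas polynomials. Then for all integers $n\ge 1$, as polynomials in $t$, $$\det\bigl(B_{i+j}(t)+B_{i+j+1}(t)\bigr)_{i,j=0}^{n-1}=(-1)^n\,t^{\binom n2}\,2^{n-1}\,L_n(-t-2,-t).$$
   Context: The Lucas polynomials are defined by $L_0(x,s)=2$, $L_1(x,s)=x$, $L_n(x,s)=xL_{n-1}(x,s)+sL_{n-2}(x,s)$ for $n\ge 2$. *)

theory Defs
  imports "Jordan_Normal_Form.Determinant"
begin

definition narayana_B :: "nat \<Rightarrow> int poly" where
  "narayana_B n = (\<Sum>k\<le>n. monom (int ((n choose k)\<^sup>2)) k)"

(* The bivariate Lucas polynomial L_n(x,s), as a polynomial function of x and s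
   in an arbitrary commutative ring. *)
fun lucas_poly :: "nat \<Rightarrow> 'a::comm_ring_1 \<Rightarrow> 'a \<Rightarrow> 'a" where
  "lucas_poly 0 x s = 2"
| "lucas_poly (Suc 0) x s = x"
| "lucas_poly (Suc (Suc n)) x s = x * lucas_poly (Suc n) x s + s * lucas_poly n x s"

abbreviation poly_t :: "int poly" where
  "poly_t \<equiv> [:0, 1:]"

end

(* Put z = (1 + x)(1 + t/x) = 1 + t + x + t/x, so that B_n(t) is the constant term of z^n.  For the
   functional "constant term" the polynomials p_0 = 1, p_k = x^k + (t/x)^k (k >= 1) in z are monic
   and orthogonal, with norms 1 and 2 t^k.  If q(i,k) is the coefficient of x^k in z^i, then
   z^i = sum_k q(i,k) p_k, so the Hankel matrix of the moments of 1 + z equals A T A^T, where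
   A = (q(i,k)) is unitriangular and T = (<p_k, (1 + z) p_l>) is tridiagonal.  The three-term
   recurrence for det T is that of the Lucas polynomials. *)
theory Submission
  imports Defs
begin

section \<open>Continuant recurrence for tridiagonal determinants\<close>

text \<open>Expansion along the last row leaves two terms. The minor \<open>?B\<close> of the
  subdiagonal one has only \<open>f n (Suc n)\<close> left in its last column, so a second expansion
  yields the determinant of size \<open>n\<close>.\<close>

lemma det_tridiagonal_Suc_Suc:
  fixes f :: "nat \<Rightarrow> nat \<Rightarrow> 'a::comm_ring_1"
  assumes up: "\<And>i j. Suc i < j \<Longrightarrow> f i j = 0"
    and low: "\<And>i j. Suc j < i \<Longrightarrow> f i j = 0"
  shows "det (mat (Suc (Suc n)) (Suc (Suc n)) (\<lambda>(i, j). f i j)) =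
    f (Suc n) (Suc n) * det (mat (Suc n) (Suc n) (\<lambda>(i, j). f i j))
    - f n (Suc n) * f (Suc n) n * det (mat n n (\<lambda>(i, j). f i j))"
    (is "det ?A = _")
proof -
  have A: "?A \<in> carrier_mat (Suc (Suc n)) (Suc (Suc n))" by simp
  let ?B = "mat_delete ?A (Suc n) n"
  have B: "?B \<in> carrier_mat (Suc n) (Suc n)" by (auto simp: mat_delete_def)
  have entry: "?B $$ (i, n) = f i (Suc n)" if "i < Suc n" for i
    using that by (simp add: mat_delete_def)
  have "det ?B = (\<Sum>i<Suc n. ?B $$ (i, n) * cofactor ?B i n)"
    by (rule laplace_expansion_column[OF B]) simp
  also have "\<dots> = ?B $$ (n, n) * cofactor ?B n n"
  proof -
    have "(\<Sum>i<n. ?B $$ (i, n) * cofactor ?B i n) = 0"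
      by (rule sum.neutral) (simp add: entry up)
    then show ?thesis by simp
  qed
  also have "cofactor ?B n n = det (mat n n (\<lambda>(i, j). f i j))"
  proof -
    have "mat_delete ?B n n = mat n n (\<lambda>(i, j). f i j)"
      by (rule eq_matI) (auto simp: mat_delete_def)
    then show ?thesis by (simp add: cofactor_def)
  qed
  finally have detB: "det ?B = f n (Suc n) * det (mat n n (\<lambda>(i, j). f i j))"
    by (simp add: entry)
  have "det ?A = (\<Sum>j<Suc (Suc n). ?A $$ (Suc n, j) * cofactor ?A (Suc n) j)"
    by (rule laplace_expansion_row[OF A]) simp
  also have "\<dots> = f (Suc n) (Suc n) * cofactor ?A (Suc n) (Suc n) + f (Suc n) n * cofactor ?A (Suc n) n"
  proof -
    have "(\<Sum>j<n. ?A $$ (Suc n, j) * cofactor ?A (Suc n) j) = 0"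
      by (rule sum.neutral) (simp add: low)
    then show ?thesis by simp
  qed
  also have "cofactor ?A (Suc n) n = - det ?B"
    by (simp add: cofactor_def)
  also have "cofactor ?A (Suc n) (Suc n) = det (mat (Suc n) (Suc n) (\<lambda>(i, j). f i j))"
  proof -
    have "mat_delete ?A (Suc n) (Suc n) = mat (Suc n) (Suc n) (\<lambda>(i, j). f i j)"
      by (rule eq_matI) (auto simp: mat_delete_def)
    then show ?thesis by (simp add: cofactor_def)
  qed
  finally show ?thesis by (simp add: detB algebra_simps)
qed

section \<open>Coefficients of powers of z\<close>

text \<open>This is q(n,k): take x^(m+k) from (1 + x)^n and (t/x)^m from (1 + t/x)^n.\<close>

definition zpow_coeff :: "nat \<Rightarrow> nat \<Rightarrow> int poly" where
  "zpow_coeff n k = (\<Sum>m\<le>n. monom (int ((n choose (m + k)) * (n choose m))) m)"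

lemma coeff_zpow_coeff: "coeff (zpow_coeff n k) m = int ((n choose (m + k)) * (n choose m))"
  by (simp add: zpow_coeff_def coeff_sum binomial_eq_0)

lemma zpow_coeff_0_right: "zpow_coeff n 0 = narayana_B n"
  by (simp add: zpow_coeff_def narayana_B_def power2_eq_square)

lemma zpow_coeff_eq_0: "n < k \<Longrightarrow> zpow_coeff n k = 0"
  by (simp add: poly_eq_iff coeff_zpow_coeff binomial_eq_0)

lemma zpow_coeff_diag: "zpow_coeff n n = 1"
  by (rule poly_eqI) (auto simp: coeff_zpow_coeff binomial_eq_0)

lemma coeff_poly_t_mult: "coeff (poly_t * p) m = (case m of 0 \<Rightarrow> 0 | Suc m \<Rightarrow> coeff p m)"
  by (simp add: coeff_pCons)

text \<open>Multiplication of z^n by z = x + (1 + t) + t/x. The coefficient of x^(-1) in z^n is t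
  q(n,1), so x and t/x contribute equally, whence the factor 2. The proof is Pascal's rule for each
  power of t.\<close>

lemma zpow_coeff_Suc_0:
  "zpow_coeff (Suc n) 0 = (1 + poly_t) * zpow_coeff n 0 + 2 * poly_t * zpow_coeff n 1"
proof -
  have "zpow_coeff (Suc n) 0 =
    zpow_coeff n 0 + poly_t * zpow_coeff n 0 + poly_t * zpow_coeff n 1 + poly_t * zpow_coeff n 1"
    by (rule poly_eqI)
      (simp only: coeff_add coeff_poly_t_mult coeff_zpow_coeff, auto split: nat.split simp: algebra_simps)
  then show ?thesis by (simp only: mult_2 ring_distribs mult_1_left add.assoc)
qed

lemma zpow_coeff_Suc_Suc:
  "zpow_coeff (Suc n) (Suc k) =
    zpow_coeff n k + (1 + poly_t) * zpow_coeff n (Suc k) + poly_t * zpow_coeff n (Suc (Suc k))"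
proof -
  have "zpow_coeff (Suc n) (Suc k) =
    zpow_coeff n k + zpow_coeff n (Suc k) + poly_t * zpow_coeff n (Suc k)
      + poly_t * zpow_coeff n (Suc (Suc k))"
    by (rule poly_eqI)
      (simp only: coeff_add coeff_poly_t_mult coeff_zpow_coeff, auto split: nat.split simp: algebra_simps)
  then show ?thesis by (simp only: ring_distribs mult_1_left add.assoc)
qed

section \<open>Jacobi matrix and moments\<close>

definition sqnorm :: "nat \<Rightarrow> int poly" where
  "sqnorm k = (if k = 0 then 1 else 2 * poly_t ^ k)"

text \<open>The matrix T. Since z p_k is p_(k+1) + (1 + t) p_k plus a multiple of p_(k-1), each
  off-diagonal entry is the norm with the larger index.\<close>

definition jacobi :: "nat \<Rightarrow> nat \<Rightarrow> int poly" where
  "jacobi k l = (if k = l then (2 + poly_t) * sqnorm k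
    else if l = Suc k then sqnorm l else if k = Suc l then sqnorm k else 0)"

lemma jacobi_commute: "jacobi k l = jacobi l k"
  by (simp add: jacobi_def)

text \<open>Both sides are the pairing of p_k with (1 + z) z^n, by orthogonality.\<close>

lemma sum_jacobi_zpow_coeff:
  assumes "n < N" "k < N"
  shows "(\<Sum>l<N. jacobi k l * zpow_coeff n l) = sqnorm k * (zpow_coeff n k + zpow_coeff (Suc n) k)"
proof -
  have "(\<Sum>l<N. jacobi k l * zpow_coeff n l) = (\<Sum>l<Suc (Suc k). jacobi k l * zpow_coeff n l)"
  proof (cases "Suc k = N")
    \<comment> \<open>For k = N - 1 the right side has the extra term l = N, which vanishes because
      n < N.\<close>
    case True
    then show ?thesis using assms by (simp add: zpow_coeff_eq_0)
  next
    case False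
    then show ?thesis
      using assms by (intro sum.mono_neutral_right) (auto simp: jacobi_def)
  qed
  also have "\<dots> = sqnorm k * (zpow_coeff n k + zpow_coeff (Suc n) k)"
  proof (cases k)
    case 0
    then show ?thesis
      by (simp only: zpow_coeff_Suc_0 lessThan_Suc lessThan_0) (simp add: jacobi_def sqnorm_def algebra_simps)
  next
    case (Suc k')
    have "(\<Sum>l<k'. jacobi k l * zpow_coeff n l) = 0"
      by (rule sum.neutral) (auto simp: jacobi_def Suc)
    then show ?thesis
      by (simp add: Suc zpow_coeff_Suc_Suc jacobi_def sqnorm_def algebra_simps del: mult_pCons_left mult_pCons_right)
  qed
  finally show ?thesis .
qed

text \<open>The pairing of z^i with z^j in the orthogonal basis, truncated at N; it is exact once i
  or j is below N.\<close>

definition zpow_inner :: "nat \<Rightarrow> nat \<Rightarrow> nat \<Rightarrow> int poly" where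
  "zpow_inner N i j = (\<Sum>k<N. zpow_coeff i k * sqnorm k * zpow_coeff j k)"

lemma zpow_inner_mono_neutral: "j < N \<Longrightarrow> N \<le> M \<Longrightarrow> zpow_inner M i j = zpow_inner N i j"
  unfolding zpow_inner_def
  by (rule sum.mono_neutral_right) (auto simp: zpow_coeff_eq_0)

lemma sum_sum_jacobi:
  assumes "i < N"
  shows "(\<Sum>k<N. \<Sum>l<N. zpow_coeff i l * jacobi l k * zpow_coeff j k)
    = zpow_inner N i j + zpow_inner N (Suc i) j"
proof -
  have "(\<Sum>k<N. \<Sum>l<N. zpow_coeff i l * jacobi l k * zpow_coeff j k)
    = (\<Sum>k<N. (\<Sum>l<N. jacobi k l * zpow_coeff i l) * zpow_coeff j k)"
    by (intro sum.cong refl) (simp add: sum_distrib_left jacobi_commute mult.commute mult.left_commute)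
  also have "\<dots> = (\<Sum>k<N. sqnorm k * (zpow_coeff i k + zpow_coeff (Suc i) k) * zpow_coeff j k)"
    using assms by (intro sum.cong refl) (simp add: sum_jacobi_zpow_coeff)
  also have "\<dots> = zpow_inner N i j + zpow_inner N (Suc i) j"
    by (simp only: zpow_inner_def sum.distrib[symmetric] ring_distribs mult.commute)
  finally show ?thesis .
qed

lemma zpow_inner_commute: "zpow_inner N i j = zpow_inner N j i"
  by (simp add: zpow_inner_def mult.commute mult.left_commute)

text \<open>Multiplication by z is self-adjoint: the symmetry of \<open>jacobi\<close> lets the same
  double sum be evaluated from either side.\<close>

lemma zpow_inner_Suc:
  assumes "i < N" "j < N"
  shows "zpow_inner N i (Suc j) = zpow_inner N (Suc i) j"
proof -
  have "zpow_inner N i j + zpow_inner N (Suc i) j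
    = (\<Sum>k<N. \<Sum>l<N. zpow_coeff i l * jacobi l k * zpow_coeff j k)"
    by (rule sum_sum_jacobi[OF assms(1), symmetric])
  also have "\<dots> = (\<Sum>l<N. \<Sum>k<N. zpow_coeff j k * jacobi k l * zpow_coeff i l)"
    by (subst sum.swap) (simp only: jacobi_commute mult.commute mult.left_commute)
  also have "\<dots> = zpow_inner N j i + zpow_inner N (Suc j) i"
    by (rule sum_sum_jacobi[OF assms(2)])
  finally show ?thesis by (simp add: zpow_inner_commute)
qed

lemma zpow_inner_eq_narayana_B_aux:
  "i + j < N \<Longrightarrow> zpow_inner N i j = narayana_B (i + j)"
proof (induction j arbitrary: i)
  case 0
  \<comment> \<open>Once all factors z have moved to the left argument, only the constant term of
    z^i remains.\<close>
  then have "zpow_inner N i 0 = zpow_inner (Suc 0) i 0"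
    by (intro zpow_inner_mono_neutral) auto
  then show ?case
    by (simp add: zpow_inner_def sqnorm_def zpow_coeff_diag zpow_coeff_0_right)
next
  case (Suc j)
  then show ?case using Suc.IH[of "Suc i"] by (simp add: zpow_inner_Suc)
qed

text \<open>Raising the truncation to N + i frees i from any bound. The last row of the Hankel
  matrix relies on this, since there \<open>Suc i\<close> equals the matrix size.\<close>

lemma zpow_inner_eq_narayana_B:
  assumes "j < N"
  shows "zpow_inner N i j = narayana_B (i + j)"
proof -
  have "zpow_inner N i j = zpow_inner (N + i) i j"
    using assms by (intro zpow_inner_mono_neutral[symmetric]) auto
  also have "\<dots> = narayana_B (i + j)"
    using assms by (intro zpow_inner_eq_narayana_B_aux) auto
  finally show ?thesis .
qed

section \<open>Evaluation of the Hankel determinant\<close>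

lemma det_hankel_eq_det_jacobi:
  "det (mat n n (\<lambda>(i, j). narayana_B (i + j) + narayana_B (i + j + 1)))
    = det (mat n n (\<lambda>(k, l). jacobi k l))"
    (is "det ?H = det ?J")
proof -
  let ?A = "mat n n (\<lambda>(i, k). zpow_coeff i k)"
  have car: "?A \<in> carrier_mat n n" "?J \<in> carrier_mat n n" "?A\<^sup>T \<in> carrier_mat n n"
    "?A * ?J \<in> carrier_mat n n" by auto
  have "?H = ?A * ?J * ?A\<^sup>T"
  proof (rule eq_matI)
    fix i j assume "i < dim_row (?A * ?J * ?A\<^sup>T)" "j < dim_col (?A * ?J * ?A\<^sup>T)"
    then have ij: "i < n" "j < n" by auto
    have "(?A * ?J * ?A\<^sup>T) $$ (i, j)
      = (\<Sum>k<n. (\<Sum>l<n. zpow_coeff i l * jacobi l k) * zpow_coeff j k)"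
      using ij by (simp add: scalar_prod_def atLeast0LessThan)
    also have "\<dots> = zpow_inner n i j + zpow_inner n (Suc i) j"
      using ij by (simp add: sum_sum_jacobi[symmetric] sum_distrib_right)
    also have "\<dots> = ?H $$ (i, j)"
      using ij by (simp add: zpow_inner_eq_narayana_B)
    finally show "?H $$ (i, j) = (?A * ?J * ?A\<^sup>T) $$ (i, j)" by simp
  qed auto
  then have "det ?H = det ?A * det ?J * det ?A"
    by (simp only: det_mult[OF car(4,3)] det_mult[OF car(1,2)] det_transpose[OF car(1)])
  moreover have "det ?A = 1"
  proof -
    have "det ?A = prod_list (diag_mat ?A)"
      by (rule det_lower_triangular[of n]) (auto simp: zpow_coeff_eq_0)
    also have "\<dots> = 1"
      by (simp add: prod_list_diag_prod zpow_coeff_diag)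
    finally show ?thesis .
  qed
  ultimately show ?thesis by simp
qed

lemma det_jacobi:
  "det (mat (Suc n) (Suc n) (\<lambda>(k, l). jacobi k l))
    = (-1) ^ Suc n * poly_t ^ (Suc n choose 2) * 2 ^ n * lucas_poly (Suc n) (- poly_t - 2) (- poly_t)"
proof (induction n rule: less_induct)
  case (less n)
  define t :: "int poly" where "t = poly_t"
  define D where "D m = det (mat m m (\<lambda>(k, l). jacobi k l))" for m
  define L where "L m = lucas_poly m (- t - 2) (- t)" for m
  have rec: "D (Suc (Suc m)) = jacobi (Suc m) (Suc m) * D (Suc m)
      - jacobi m (Suc m) * jacobi (Suc m) m * D m" for m
    unfolding D_def by (rule det_tridiagonal_Suc_Suc) (auto simp: jacobi_def)
  have D0: "D 0 = 1" by (simp add: D_def)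
  have D1: "D (Suc 0) = 2 + t"
    by (simp add: D_def det_single jacobi_def sqnorm_def t_def)
  have diag: "jacobi (Suc m) (Suc m) = (2 + t) * (2 * t ^ Suc m)" for m
    by (simp add: jacobi_def sqnorm_def t_def)
  have off: "jacobi m (Suc m) = 2 * t ^ Suc m" "jacobi (Suc m) m = 2 * t ^ Suc m" for m
    by (simp_all add: jacobi_def sqnorm_def t_def)
  have IH: "D (Suc m) = (-1) ^ Suc m * t ^ (Suc m choose 2) * 2 ^ m * L (Suc m)" if "m < n" for m
    using less.IH[OF that] by (simp only: D_def t_def L_def)
  have ch: "Suc m choose 2 = m + (m choose 2)" for m
    by (simp add: numeral_2_eq_2)
  have "D (Suc n) = (-1) ^ Suc n * t ^ (Suc n choose 2) * 2 ^ n * L (Suc n)"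
  proof (cases n)
    case 0
    then show ?thesis by (simp add: D1 L_def ch binomial_eq_0)
  next
    case n: (Suc m)
    show ?thesis
    proof (cases m)
      \<comment> \<open>Size 2 is separate: \<open>D 0 = 1\<close> would need the exponent -1 of 2
        to match \<open>L 0 = 2\<close>.\<close>
      case 0
      then show ?thesis
        by (simp add: n rec D0 D1 diag off L_def ch binomial_eq_0 algebra_simps power2_eq_square)
    next
      case (Suc k)
      have "D (Suc (Suc m)) = (2 + t) * (2 * t ^ Suc m) * D (Suc m) - (2 * t ^ Suc m)\<^sup>2 * D m"
        by (simp only: rec diag off power2_eq_square)
      also have "D (Suc m) = (-1) ^ Suc m * t ^ (Suc m choose 2) * 2 ^ m * L (Suc m)"
        using n by (intro IH) simp
      also have "D m = (-1) ^ m * t ^ (m choose 2) * 2 ^ k * L m"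
        using n Suc IH[of k] by simp
      \<comment> \<open>Both terms carry 2^(m+1), as m = k + 1. The second has one surplus t, since
        2(m+1) + (m choose 2) exceeds (m+2 choose 2) by 1; this supplies the Lucas parameter s =
        -t.\<close>
      also have "(2 + t) * (2 * t ^ Suc m) * ((-1) ^ Suc m * t ^ (Suc m choose 2) * 2 ^ m * L (Suc m))
          - (2 * t ^ Suc m)\<^sup>2 * ((-1) ^ m * t ^ (m choose 2) * 2 ^ k * L m)
        = (-1) ^ Suc (Suc m) * t ^ (Suc (Suc m) choose 2) * 2 ^ Suc m
          * ((- t - 2) * L (Suc m) + (- t) * L m)"
        by (simp add: ch Suc power_add power2_eq_square algebra_simps)
      also have "(- t - 2) * L (Suc m) + (- t) * L m = L (Suc (Suc m))"
        by (simp add: L_def)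
      finally show ?thesis by (simp only: n)
    qed
  qed
  then show ?case by (simp only: D_def t_def L_def)
qed

theorem mainTheorem6:
  fixes n :: nat
  assumes "n \<ge> 1"
  shows "det (mat n n (\<lambda>(i, j). narayana_B (i + j) + narayana_B (i + j + 1))) =
    (-1) ^ n * poly_t ^ (n choose 2) * 2 ^ (n - 1) * lucas_poly n (- poly_t - 2) (- poly_t)"
proof -
  obtain m where "n = Suc m" using assms by (cases n) auto
  then show ?thesis by (simp only: det_hankel_eq_det_jacobi det_jacobi diff_Suc_1)
qed

end
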